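(* Let $\alpha=\frac{1-q}{1+ac+a+c}$, $\gamma=\frac{-(1-q)ac}{1+ac+a+c}$ and $\tilde\rho_r=\alpha^r(1-q)^r$. For every $N\ge0$, $r\ge0$ and every word $X\in\{D,E\}^N$ (interpreted as the corresponding matrix product), $$\langle W|X|V^r\rangle\cdot\tilde\rho_r=\sum_{Z\in S_r(X)}q^{\mathrm{inv}_E(Z)}\,\alpha^{|D(Z)|}\,\gamma^{|E(Z)|}\,\frac{\langle W|Z|V\rangle}{\langle W|A^r|V\rangle}.$$
   Context: Fix generic complex parameters $a,b,c,d,q$. For integers $n\ge0$ define $\mathcal{A}_n=\frac{(1-q^{n-1}abcd)(1-q^{n+1})(1-q^nab)(1-q^nac)(1-q^nad)(1-q^nbc)(1-q^nbd)(1-q^ncd)}{(1-q^{2n-1}abcd)(1-q^{2n}abcd)^2(1-q^{2n+1}abcd)}$, $d_n^\natural=\frac{q^{n-1}}{(1-q^{2n-2}abcd)(1-q^{2n}abcd)}\big[bd(a+c)+(b+d)q-abcd(b+d)q^{n-1}-\{bd(a+c)+abcd(b+d)\}q^n-bd(a+c)q^{n+1}+ab^2cd^2(a+c)q^{2n-1}+abcd(b+d)q^{2n}\big]$, $e_n^\natural=\frac{q^{n-1}}{(1-q^{2n-2}abcd)(1-q^{2n}abcd)}\big[ac(b+d)+(a+c)q-abcd(a+c)q^{n-1}-\{ac(b+d)+abcd(a+c)\}q^n-ac(b+d)q^{n+1}+a^2bc^2d(b+d)q^{2n-1}+abcd(a+c)q^{2n}\big]$, $d_n^\sharp=1$, $d_n^\flat=-\frac{q^nbd}{(1-q^nac)(1-q^nbd)}\mathcal{A}_n$,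 $e_n^\sharp=-q^nac$, $e_n^\flat=\frac{\mathcal{A}_n}{(1-q^nac)(1-q^nbd)}$. Let $\mathsf d,\mathsf e$ be the infinite tridiagonal matrices indexed by $\{0,1,\dots\}$ with nonzero entries $\mathsf d_{n,n}=d_n^\natural$, $\mathsf d_{n,n+1}=d_n^\sharp$, $\mathsf d_{n+1,n}=d_n^\flat$, and similarly for $\mathsf e$. Put $D=\frac{1}{1-q}(I+\mathsf d)$, $E=\frac{1}{1-q}(I+\mathsf e)$, $A=DE-ED$. Let $\langle W|=(1,0,0,\dots)$, $|V\rangle=\langle W|^T$, and $|V^r\rangle$ the column vector with $1$ in position $r$ (positions indexed from $0$) and $0$ elsewhere. For a word $X\in\{D,E\}^N$, $S_r(X)$ is the set of words obtained from $X$ by replacing exactly $r$ of its letters by $A$. For $Z\in S_r(X)$, $D(Z)$ (resp. $E(Z)$) is the set of positions of letters that were $D$ (resp. $E$) in $X$ and became $A$ in $Z$, and $\mathrm{inv}_E(Z)=\sum_{j\in E(Z)}|\{i\in D(Z)\cup E(Z): i<j\}|$. Words in $D,E,A$ are interpreted as matrix products. *)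

theory Defs
  imports Complex_Main "HOL-Library.Groups_Big_Fun"
begin

text \<open>
  Infinite matrices and vectors, indexed by the natural numbers. \<^const>\<open>Sum_any\<close> sums over the
  support of the summand and yields 0 if that support is infinite; for the matrices below, all of
  which have finite rows and columns, every support is finite.
\<close>

type_synonym inf_mat = "nat \<Rightarrow> nat \<Rightarrow> complex"
type_synonym inf_vec = "nat \<Rightarrow> complex"

definition mat_id :: inf_mat where
  "mat_id = (\<lambda>i j. if i = j then 1 else 0)"

definition mat_add :: "inf_mat \<Rightarrow> inf_mat \<Rightarrow> inf_mat" where
  "mat_add M N = (\<lambda>i j. M i j + N i j)"

definition mat_diff :: "inf_mat \<Rightarrow> inf_mat \<Rightarrow> inf_mat" where
  "mat_diff M N = (\<lambda>i j. M i j - N i j)"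

definition mat_scale :: "complex \<Rightarrow> inf_mat \<Rightarrow> inf_mat" where
  "mat_scale s M = (\<lambda>i j. s * M i j)"

definition mat_mult :: "inf_mat \<Rightarrow> inf_mat \<Rightarrow> inf_mat" where
  "mat_mult M N = (\<lambda>i j. Sum_any (\<lambda>k. M i k * N k j))"

definition bra_mat_ket :: "inf_vec \<Rightarrow> inf_mat \<Rightarrow> inf_vec \<Rightarrow> complex" where
  "bra_mat_ket w M v = Sum_any (\<lambda>i. Sum_any (\<lambda>j. w i * M i j * v j))"

definition ket_V_at :: "nat \<Rightarrow> inf_vec" where
  "ket_V_at r = (\<lambda>i. if i = r then 1 else 0)"

definition bra_W :: inf_vec where
  "bra_W = (\<lambda>i. if i = 0 then 1 else 0)"

definition ket_V :: inf_vec where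
  "ket_V = bra_W"

definition tridiag :: "(nat \<Rightarrow> complex) \<Rightarrow> (nat \<Rightarrow> complex) \<Rightarrow> (nat \<Rightarrow> complex) \<Rightarrow> inf_mat" where
  "tridiag diag upper lower = (\<lambda>i j.
     if j = i then diag i
     else if j = Suc i then upper i
     else if i = Suc j then lower j
     else 0)"

text \<open>
  Genericity of the parameters. The conditions make every denominator in the entries of the
  matrices and in \<open>\<alpha>\<close>, \<open>\<gamma>\<close> nonzero (the exponents of \<open>q\<close> next to \<open>abcd\<close> start at \<open>-2\<close>). The products
  \<open>ab\<close>, \<open>ad\<close>, \<open>bc\<close>, \<open>cd\<close> occur because \<open>\<langle>W|A\<^sup>r|V\<rangle>\<close>, by which the theorem divides, is the product over
  \<open>0 \<le> i < r\<close> of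
  \<open>(1 - q\<^sup>i ab) (1 - q\<^sup>i ad) (1 - q\<^sup>i bc) (1 - q\<^sup>i cd)\<close> divided by
  \<open>(1 - q) (1 - q\<^bsup>2i\<^esup> abcd) (1 - q\<^bsup>2i+1\<^esup> abcd)\<close>.
\<close>

definition generic_params ::
  "complex \<Rightarrow> complex \<Rightarrow> complex \<Rightarrow> complex \<Rightarrow> complex \<Rightarrow> bool" where
  "generic_params a b c d q \<longleftrightarrow>
     q \<noteq> 0 \<and> q \<noteq> 1 \<and>
     1 + a*c + a + c \<noteq> 0 \<and>
     (\<forall>k::int. k \<ge> -2 \<longrightarrow> 1 - q powi k * (a*b*c*d) \<noteq> 0) \<and>
     (\<forall>n::nat. \<forall>x \<in> {a*b, a*c, a*d, b*c, b*d, c*d}. 1 - q ^ n * x \<noteq> 0)"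

definition calA ::
  "complex \<Rightarrow> complex \<Rightarrow> complex \<Rightarrow> complex \<Rightarrow> complex \<Rightarrow> nat \<Rightarrow> complex" where
  "calA a b c d q n =
     ((1 - q powi (int n - 1) * (a*b*c*d)) * (1 - q ^ (n + 1))
       * (1 - q^n * (a*b)) * (1 - q^n * (a*c)) * (1 - q^n * (a*d))
       * (1 - q^n * (b*c)) * (1 - q^n * (b*d)) * (1 - q^n * (c*d)))
     / ((1 - q powi (2 * int n - 1) * (a*b*c*d)) * (1 - q ^ (2*n) * (a*b*c*d))\<^sup>2
       * (1 - q ^ (2*n + 1) * (a*b*c*d)))"

definition d_nat ::
  "complex \<Rightarrow> complex \<Rightarrow> complex \<Rightarrow> complex \<Rightarrow> complex \<Rightarrow> nat \<Rightarrow> complex" where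
  "d_nat a b c d q n =
     q powi (int n - 1)
     / ((1 - q powi (2 * int n - 2) * (a*b*c*d)) * (1 - q ^ (2*n) * (a*b*c*d)))
     * (b*d*(a+c) + (b+d)*q
        - a*b*c*d*(b+d) * q powi (int n - 1)
        - (b*d*(a+c) + a*b*c*d*(b+d)) * q ^ n
        - b*d*(a+c) * q ^ (n + 1)
        + a*b\<^sup>2*c*d\<^sup>2*(a+c) * q powi (2 * int n - 1)
        + a*b*c*d*(b+d) * q ^ (2*n))"

definition e_nat ::
  "complex \<Rightarrow> complex \<Rightarrow> complex \<Rightarrow> complex \<Rightarrow> complex \<Rightarrow> nat \<Rightarrow> complex" where
  "e_nat a b c d q n =
     q powi (int n - 1)
     / ((1 - q powi (2 * int n - 2) * (a*b*c*d)) * (1 - q ^ (2*n) * (a*b*c*d)))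
     * (a*c*(b+d) + (a+c)*q
        - a*b*c*d*(a+c) * q powi (int n - 1)
        - (a*c*(b+d) + a*b*c*d*(a+c)) * q ^ n
        - a*c*(b+d) * q ^ (n + 1)
        + a\<^sup>2*b*c\<^sup>2*d*(b+d) * q powi (2 * int n - 1)
        + a*b*c*d*(a+c) * q ^ (2*n))"

definition d_sharp :: "nat \<Rightarrow> complex" where
  "d_sharp n = 1"

definition d_flat ::
  "complex \<Rightarrow> complex \<Rightarrow> complex \<Rightarrow> complex \<Rightarrow> complex \<Rightarrow> nat \<Rightarrow> complex" where
  "d_flat a b c d q n =
     - (q^n * (b*d)) / ((1 - q^n * (a*c)) * (1 - q^n * (b*d))) * calA a b c d q n"

definition e_sharp :: "complex \<Rightarrow> complex \<Rightarrow> complex \<Rightarrow> nat \<Rightarrow> complex" where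
  "e_sharp a c q n = - (q^n * (a*c))"

definition e_flat ::
  "complex \<Rightarrow> complex \<Rightarrow> complex \<Rightarrow> complex \<Rightarrow> complex \<Rightarrow> nat \<Rightarrow> complex" where
  "e_flat a b c d q n =
     calA a b c d q n / ((1 - q^n * (a*c)) * (1 - q^n * (b*d)))"

definition mat_D ::
  "complex \<Rightarrow> complex \<Rightarrow> complex \<Rightarrow> complex \<Rightarrow> complex \<Rightarrow> inf_mat" where
  "mat_D a b c d q = mat_scale (1 / (1 - q))
     (mat_add mat_id (tridiag (d_nat a b c d q) d_sharp (d_flat a b c d q)))"

definition mat_E ::
  "complex \<Rightarrow> complex \<Rightarrow> complex \<Rightarrow> complex \<Rightarrow> complex \<Rightarrow> inf_mat" where
  "mat_E a b c d q = mat_scale (1 / (1 - q))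
     (mat_add mat_id (tridiag (e_nat a b c d q) (e_sharp a c q) (e_flat a b c d q)))"

definition mat_A ::
  "complex \<Rightarrow> complex \<Rightarrow> complex \<Rightarrow> complex \<Rightarrow> complex \<Rightarrow> inf_mat" where
  "mat_A a b c d q =
     mat_diff (mat_mult (mat_D a b c d q) (mat_E a b c d q))
              (mat_mult (mat_E a b c d q) (mat_D a b c d q))"

datatype letter = LD | LE | LA

type_synonym wrd = "letter list"

fun letter_mat ::
  "complex \<Rightarrow> complex \<Rightarrow> complex \<Rightarrow> complex \<Rightarrow> complex \<Rightarrow> letter \<Rightarrow> inf_mat" where
  "letter_mat a b c d q LD = mat_D a b c d q"
| "letter_mat a b c d q LE = mat_E a b c d q"
| "letter_mat a b c d q LA = mat_A a b c d q"

definition word_mat ::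
  "complex \<Rightarrow> complex \<Rightarrow> complex \<Rightarrow> complex \<Rightarrow> complex \<Rightarrow> wrd \<Rightarrow> inf_mat" where
  "word_mat a b c d q w = foldr mat_mult (map (letter_mat a b c d q) w) mat_id"

definition replacements :: "nat \<Rightarrow> wrd \<Rightarrow> wrd set" where
  "replacements r X = {Z. length Z = length X \<and>
     (\<forall>i < length X. Z ! i \<noteq> X ! i \<longrightarrow> Z ! i = LA) \<and>
     card {i. i < length X \<and> Z ! i \<noteq> X ! i} = r}"

definition D_pos :: "wrd \<Rightarrow> wrd \<Rightarrow> nat set" where
  "D_pos X Z = {i. i < length X \<and> X ! i = LD \<and> Z ! i = LA}"

definition E_pos :: "wrd \<Rightarrow> wrd \<Rightarrow> nat set" where
  "E_pos X Z = {i. i < length X \<and> X ! i = LE \<and> Z ! i = LA}"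

definition inv_E :: "wrd \<Rightarrow> wrd \<Rightarrow> nat" where
  "inv_E X Z = (\<Sum>j \<in> E_pos X Z. card {i \<in> D_pos X Z \<union> E_pos X Z. i < j})"

definition par_alpha :: "complex \<Rightarrow> complex \<Rightarrow> complex \<Rightarrow> complex" where
  "par_alpha a c q = (1 - q) / (1 + a*c + a + c)"

definition par_gamma :: "complex \<Rightarrow> complex \<Rightarrow> complex \<Rightarrow> complex" where
  "par_gamma a c q = - (1 - q) * (a*c) / (1 + a*c + a + c)"

definition rho_tilde :: "complex \<Rightarrow> complex \<Rightarrow> complex \<Rightarrow> nat \<Rightarrow> complex" where
  "rho_tilde a c q r = par_alpha a c q ^ r * (1 - q) ^ r"

end

theory Submission
  imports Defs "HOL-Analysis.Uncountable_Sets"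
begin

text \<open>
  The matrices satisfy \<open>de - q ed = 1 - q\<close>, hence \<open>dA = q Ad\<close> and \<open>Ae = q eA\<close>. Put
  \<open>g\<^sub>t = e + ac q\<^bsup>2t\<^esup> d - (a+c) q\<^sup>t\<close> and \<open>B\<^sub>r = g\<^sub>0 \<dots> g\<^bsub>r-1\<^esub>\<close>. Then \<open>\<langle>W| B\<^sub>r = 0\<close> for \<open>r > 0\<close>,
  \<open>[D, B\<^sub>r] = (1 - q\<^sup>r) B\<^bsub>r-1\<^esub> A\<close> and \<open>[E, B\<^sub>r] = - ac q\<^bsup>r-1\<^esup> (1 - q\<^sup>r) B\<^bsub>r-1\<^esub> A\<close>. Moving \<open>B\<^sub>r\<close> to the left
  through \<open>\<langle>W| X B\<^sub>r |V\<rangle>\<close> therefore produces, up to a constant factor, the weighted sum over \<open>S\<^sub>r(X)\<close>.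
  That sum is empty for words shorter than \<open>r\<close>, so \<open>B\<^sub>r |V\<rangle>\<close> vanishes below position \<open>r\<close>; it vanishes above
  because each \<open>g\<^sub>t\<close> is tridiagonal. Thus \<open>B\<^sub>r |V\<rangle>\<close> is a multiple of \<open>|V\<^sup>r\<rangle>\<close>, and the word \<open>D\<^sup>r\<close> determines the
  multiple in terms of \<open>\<langle>W|A\<^sup>r|V\<rangle>\<close>. The constant factor is nonzero unless \<open>q\<close> is a root of unity; that
  case follows by continuity in \<open>q\<close>.
\<close>

section \<open>Entries of the tridiagonal matrices\<close>

text \<open>
  With \<open>y = q\<^bsup>n-1\<^esup>\<close> and \<open>s = abcd\<close>, the diagonal entries are
  \<open>d\<^sub>n = bd(a+c) u + (b+d) v\<close> and \<open>e\<^sub>n = ac(b+d) u + (a+c) v\<close>, where \<open>u\<close>, \<open>v\<close> depend on \<open>s\<close>, \<open>q\<close>, \<open>y\<close> only.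
  Comparing coefficients of the monomials in \<open>a+c\<close> and \<open>b+d\<close> thus turns each entry of
  \<open>de - q ed = 1 - q\<close> into identities in three variables.
\<close>

definition diag_u :: "complex \<Rightarrow> complex \<Rightarrow> complex \<Rightarrow> complex" where
  "diag_u s q y = y * (1 - q*y - q^2*y + s*q*y^2) / ((1 - s*y^2) * (1 - s*q^2*y^2))"

definition diag_v :: "complex \<Rightarrow> complex \<Rightarrow> complex \<Rightarrow> complex" where
  "diag_v s q y = y * (q - s*y - s*q*y + s*q^2*y^2) / ((1 - s*y^2) * (1 - s*q^2*y^2))"

definition prod4 :: "complex \<Rightarrow> complex \<Rightarrow> complex \<Rightarrow> complex \<Rightarrow> complex \<Rightarrow> complex" where
  "prod4 a b c d t = (1 - t*(a*b)) * (1 - t*(a*d)) * (1 - t*(b*c)) * (1 - t*(c*d))"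

lemma diag_uv_shift:
  assumes "1 - s*y^2 \<noteq> 0" "1 - s*q^2*y^2 \<noteq> 0" "1 - s*q^4*y^2 \<noteq> 0"
  shows "diag_u s q (q*y) - q * diag_u s q y - q*y * diag_v s q y + q^2*y * diag_v s q (q*y) = 0"
    and "diag_v s q (q*y) - q * diag_v s q y - s*q*y * diag_u s q y + s*q^2*y * diag_u s q (q*y) = 0"
  using assms unfolding diag_u_def diag_v_def power_mult_distrib
  by (simp add: divide_simps, algebra)+

lemma diag_uv_product:
  assumes "1 - s*y^2 \<noteq> 0" "1 - s*q*y^2 \<noteq> 0" "1 - s*q^2*y^2 \<noteq> 0"
  shows "(1 - s*y)*(1 - q^2*y)*(q*y)^2 / ((1 - s*q*y^2)*(1 - s*q^2*y^2)^2)
      - (q - s*y)*(1 - q*y)*y^2 / ((1 - s*y^2)^2*(1 - s*q*y^2))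
      + (1 - q) * (diag_u s q y * diag_v s q y) = 0"
  using assms unfolding diag_u_def diag_v_def power_mult_distrib
  by (simp add: divide_simps, algebra)

lemma diag_uv_squares:
  assumes "1 - s*y^2 \<noteq> 0" "1 - s*q*y^2 \<noteq> 0" "1 - s*q^2*y^2 \<noteq> 0"
  shows "(1 - s*y)*(1 - q^2*y)*(q*y + s*(q*y)^3) / ((1 - s*q*y^2)*(1 - s*q^2*y^2)^2)
      - (q - s*y)*(1 - q*y)*(y + s*y^3) / ((1 - s*y^2)^2*(1 - s*q*y^2))
      - (1 - q) * (s * (diag_u s q y)^2 + (diag_v s q y)^2) = 0"
  using assms unfolding diag_u_def diag_v_def power_mult_distrib
  by (simp add: divide_simps, algebra)

lemma prod4_expand:
  "prod4 a b c d t = (1 - a*b*c*d*t^2)^2 - (a + c)*(b + d)*(t + a*b*c*d*t^3)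
     + (b*d*(a + c)^2 + a*c*(b + d)^2)*t^2"
  unfolding prod4_def by algebra

lemma diagonal_identity:
  assumes s: "s = a*b*c*d"
    and nz: "1 - s*y^2 \<noteq> 0" "1 - s*q*y^2 \<noteq> 0" "1 - s*q^2*y^2 \<noteq> 0"
  defines "u \<equiv> diag_u s q y" and "v \<equiv> diag_v s q y"
  shows "(1 - s*y)*(1 - q^2*y)*prod4 a b c d (q*y) / ((1 - s*q*y^2)*(1 - s*q^2*y^2)^2)
      - (q - s*y)*(1 - q*y)*prod4 a b c d y / ((1 - s*y^2)^2*(1 - s*q*y^2))
      + (1 - q) * ((b*d*(a + c)*u + (b + d)* v) * (a*c*(b + d)*u + (a + c)* v)) = 1 - q"
proof -
  define S where "S = (a + c)*(b + d)"
  define T where "T = b*d*(a + c)^2 + a*c*(b + d)^2"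
  define K L where "K = (1 - s*y)*(1 - q^2*y) / ((1 - s*q*y^2)*(1 - s*q^2*y^2)^2)"
    and "L = (q - s*y)*(1 - q*y) / ((1 - s*y^2)^2*(1 - s*q*y^2))"
  have e: "(b*d*(a + c)*u + (b + d)* v) * (a*c*(b + d)*u + (a + c)* v)
      = S * (s * u^2 + v^2) + T * (u* v)"
    unfolding S_def T_def s by algebra
  have P: "prod4 a b c d t = (1 - s*t^2)^2 - S*(t + s*t^3) + T*t^2" for t
    unfolding S_def T_def s prod4_expand by simp
  have h1: "K * (q*y)^2 - L * y^2 + (1 - q) * (u* v) = 0"
    using diag_uv_product[OF nz] by (simp add: K_def L_def u_def v_def)
  have h2: "K * (q*y + s*(q*y)^3) - L * (y + s*y^3) - (1 - q) * (s*u^2 + v^2) = 0"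
    using diag_uv_squares[OF nz] by (simp add: K_def L_def u_def v_def)
  have K1: "K * (1 - s*(q*y)^2)^2 = (1 - s*y)*(1 - q^2*y) / (1 - s*q*y^2)"
    using nz unfolding K_def by (simp add: power_mult_distrib mult.assoc)
  have L1: "L * (1 - s*y^2)^2 = (q - s*y)*(1 - q*y) / (1 - s*q*y^2)"
    using nz unfolding L_def by simp
  have h0: "K * (1 - s*(q*y)^2)^2 - L * (1 - s*y^2)^2 = 1 - q"
    unfolding K1 L1 using nz by (simp add: divide_simps, algebra)
  have "K * prod4 a b c d (q*y) - L * prod4 a b c d y + (1 - q) * (S * (s*u^2 + v^2) + T * (u* v)) = 1 - q"
    unfolding P using h0 h1 h2 by algebra
  thus ?thesis unfolding e by (simp add: K_def L_def)
qed

section \<open>Tridiagonal operators on column vectors\<close>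

definition tri_op :: "(nat \<Rightarrow> complex) \<Rightarrow> (nat \<Rightarrow> complex) \<Rightarrow> (nat \<Rightarrow> complex) \<Rightarrow> inf_vec \<Rightarrow> inf_vec" where
  "tri_op dg up lo v = (\<lambda>i. dg i * v i + up i * v (Suc i) + (case i of 0 \<Rightarrow> 0 | Suc j \<Rightarrow> lo j * v j))"

definition lin_op :: "(inf_vec \<Rightarrow> inf_vec) \<Rightarrow> bool" where
  "lin_op f \<longleftrightarrow> (\<forall>x y u v. f (\<lambda>i. x * u i + y * v i) = (\<lambda>i. x * f u i + y * f v i))"

lemma lin_opD: "lin_op f \<Longrightarrow> f (\<lambda>i. x * u i + y * v i) = (\<lambda>i. x * f u i + y * f v i)"
  by (simp add: lin_op_def)

lemma lin_op_scale: "lin_op f \<Longrightarrow> f (\<lambda>i. x * u i) = (\<lambda>i. x * f u i)"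
  using lin_opD[of f x u 0 u] by simp

lemma lin_op_id: "lin_op (\<lambda>v. v)"
  by (simp add: lin_op_def)

lemma lin_op_comp: "lin_op f \<Longrightarrow> lin_op g \<Longrightarrow> lin_op (\<lambda>v. f (g v))"
  by (simp add: lin_op_def)

lemma lin_op_tri: "lin_op (tri_op dg up lo)"
  by (auto simp: lin_op_def tri_op_def fun_eq_iff algebra_simps split: nat.split)

locale generic_quintuple =
  fixes a b c d q :: complex
  assumes gen: "generic_params a b c d q"
begin

definition s where "s = a*b*c*d"
definition y where "y n = q powi (int n - 1)"
definition "dn = d_nat a b c d q"
definition "en = e_nat a b c d q"
definition "fl = e_flat a b c d q"

lemma q_nonzero: "q \<noteq> 0" and q_neq_1: "q \<noteq> 1" and denom_nonzero: "1 + a*c + a + c \<noteq> 0"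
  using gen by (auto simp: generic_params_def)

lemma s_nz: "k \<ge> -2 \<Longrightarrow> 1 - s * q powi k \<noteq> 0"
  using gen by (auto simp: generic_params_def s_def mult.commute)

lemma pow_y:
  "q powi (int n - 1) = y n" "q powi (2 * int n - 2) = (y n)^2" "q powi (2 * int n - 1) = q * (y n)^2"
  "q ^ n = q * y n" "q ^ (n + 1) = q^2 * y n" "q ^ (2*n) = q^2 * (y n)^2" "q ^ (2*n + 1) = q^3 * (y n)^2"
proof -
  have yn: "q powi (int n - 1) = q ^ n / q"
    using q_nonzero by (simp add: power_int_diff)
  have e2: "q powi (2 * int n) = (q ^ n)^2"
    using power_int_of_nat[of q "2*n"] by (simp add: power_even_eq)
  show "q powi (int n - 1) = y n" by (simp add: y_def)
  show "q ^ n = q * y n" using q_nonzero by (simp add: yn y_def)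
  show "q powi (2 * int n - 2) = (y n)^2"
    using q_nonzero by (simp add: yn y_def power_int_diff e2 power_divide)
  show "q powi (2 * int n - 1) = q * (y n)^2"
    using q_nonzero by (simp add: yn y_def power_int_diff e2 power_divide power2_eq_square)
  show "q ^ (2*n) = q^2 * (y n)^2" using q_nonzero by (simp add: yn y_def power_divide power_even_eq)
  show "q ^ (n + 1) = q^2 * y n" using q_nonzero by (simp add: yn y_def power2_eq_square)
  show "q ^ (2*n + 1) = q^3 * (y n)^2"
    using q_nonzero by (simp add: yn y_def power_even_eq power2_eq_square power3_eq_cube)
qed

lemma y_Suc: "y (Suc n) = q * y n"
  using q_nonzero pow_y(4)[of n] by (simp add: y_def)

lemma y_nz: "1 - s * (y n)^2 \<noteq> 0" "1 - s*q * (y n)^2 \<noteq> 0" "1 - s*q^2 * (y n)^2 \<noteq> 0"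
  "1 - s*q^3 * (y n)^2 \<noteq> 0" "1 - s*q^4 * (y n)^2 \<noteq> 0" "1 - s * y n \<noteq> 0"
proof -
  have 0: "q powi (2 * int n - 2 + int k) = q^k * (y n)^2" for k
    using q_nonzero by (simp add: power_int_add pow_y)
  have 1: "1 - s * (q^k * (y n)^2) \<noteq> 0" for k
    using s_nz[of "2 * int n - 2 + int k"] by (simp add: 0)
  show "1 - s * (y n)^2 \<noteq> 0" "1 - s*q * (y n)^2 \<noteq> 0" "1 - s*q^2 * (y n)^2 \<noteq> 0"
    "1 - s*q^3 * (y n)^2 \<noteq> 0" "1 - s*q^4 * (y n)^2 \<noteq> 0"
    using 1[of 0] 1[of 1] 1[of 2] 1[of 3] 1[of 4] by (simp_all add: mult.assoc)
  show "1 - s * y n \<noteq> 0" using s_nz[of "int n - 1"] by (simp add: y_def)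
qed

lemma diag_split:
  assumes "N = c1 * u + c2 * v" "D = s * Y^2" "E = s * q^2 * Y^2"
  shows "Y / ((1 - D) * (1 - E)) * N =
    c1 * (Y * u / ((1 - s*Y^2) * (1 - s*q^2*Y^2))) + c2 * (Y * v / ((1 - s*Y^2) * (1 - s*q^2*Y^2)))"
  unfolding assms by (simp add: add_divide_distrib distrib_left mult_ac)

lemma dn_uv: "dn n = b*d*(a + c) * diag_u s q (y n) + (b + d) * diag_v s q (y n)"
  unfolding dn_def d_nat_def diag_u_def diag_v_def pow_y[of n]
  by (rule diag_split; unfold s_def; algebra)

lemma en_uv: "en n = a*c*(b + d) * diag_u s q (y n) + (a + c) * diag_v s q (y n)"
  unfolding en_def e_nat_def diag_u_def diag_v_def pow_y[of n]
  by (rule diag_split; unfold s_def; algebra)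

lemma fl_closed: "fl n = (1 - s * y n) * (1 - q^2 * y n) * prod4 a b c d (q * y n)
    / ((1 - s*q*(y n)^2) * (1 - s*q^2*(y n)^2)^2 * (1 - s*q^3*(y n)^2))"
proof -
  have "1 - q^n * (a*c) \<noteq> 0" "1 - q^n * (b*d) \<noteq> 0"
    using gen by (auto simp: generic_params_def)
  hence nz: "1 - q * y n * (a*c) \<noteq> 0" "1 - q * y n * (b*d) \<noteq> 0" unfolding pow_y(4) .
  have can: "M * A1 * A2 * A3 * A4 * A5 * A6 / D / (A2 * A5) = M * (A1 * A3 * A4 * A6) / D"
    if "A2 \<noteq> 0" "A5 \<noteq> 0" for M A1 A2 A3 A4 A5 A6 D :: complex
    using that by (simp add: divide_simps)
  show ?thesis
    unfolding fl_def e_flat_def calA_def pow_y[of n] can[OF nz] prod4_def s_def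
    by (simp only: mult_ac)
qed

lemma d_flat_fl: "d_flat a b c d q n = - (q^n * (b*d)) * fl n"
  by (simp add: d_flat_def fl_def e_flat_def)

lemma en_Suc: "en (Suc n) + a*c*q^(Suc n) * dn (Suc n) = q * en n + a*c*q^n * dn n"
proof -
  note h = diag_uv_shift[OF y_nz(1,3,5), of n]
  have s: "s = (a*c)*(b*d)" by (simp add: s_def)
  show ?thesis
    unfolding dn_uv en_uv y_Suc power_Suc pow_y(4)[of n]
    using h unfolding s by algebra
qed

lemma dn_Suc: "dn (Suc n) + b*d*q^(Suc n) * en (Suc n) = q * dn n + b*d*q^n * en n"
proof -
  note h = diag_uv_shift[OF y_nz(1,3,5), of n]
  have s: "s = (a*c)*(b*d)" by (simp add: s_def)
  show ?thesis
    unfolding dn_uv en_uv y_Suc power_Suc pow_y(4)[of n]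
    using h unfolding s by algebra
qed

lemma fl_diag_0: "fl 0 * (1 - s*q) + (1 - q) * (dn 0 * en 0) = 1 - q"
proof -
  have y0: "q * y 0 = 1" using pow_y(4)[of 0] by simp
  have "fl 0 * (1 - s*q^3*(y 0)^2) = (1 - s * y 0) * (1 - q^2 * y 0) * prod4 a b c d (q * y 0)
    / ((1 - s*q*(y 0)^2) * (1 - s*q^2*(y 0)^2)^2)"
    using y_nz(4)[of 0] by (simp add: fl_closed)
  moreover have "s*q^3*(y 0)^2 = s*q" using y0 by algebra
  ultimately show ?thesis
    using diagonal_identity[OF s_def y_nz(1-3)[of 0]] y0 by (simp add: dn_uv en_uv)
qed

lemma fl_diag_Suc:
  "fl (Suc n) * (1 - s*q^3*(q^n)^2) - fl n * (q - s * (q^n)^2)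
     + (1 - q) * (dn (Suc n) * en (Suc n)) = 1 - q"
proof -
  define z where "z = y (Suc n)"
  have z: "z = q * y n" by (simp add: z_def y_Suc)
  have zq: "q^n = z" by (simp add: z pow_y(4))
  have "fl (Suc n) * (1 - s*q^3*z^2) = (1 - s * z) * (1 - q^2 * z) * prod4 a b c d (q * z)
    / ((1 - s*q*z^2) * (1 - s*q^2*z^2)^2)"
    using y_nz(4)[of "Suc n"] by (simp add: fl_closed z_def)
  moreover have "fl n * (q - s*z^2) = (q - s*z)*(1 - q*z)*prod4 a b c d z
    / ((1 - s*z^2)^2*(1 - s*q*z^2))"
  proof -
    have "fl n * (q - s*z^2) = q * fl n * (1 - s*q*(y n)^2)"
      unfolding z by algebra
    also have "\<dots> = q * ((1 - s * y n) * (1 - q^2 * y n) * prod4 a b c d (q * y n))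
      / ((1 - s*q^2*(y n)^2)^2 * (1 - s*q^3*(y n)^2))"
      using y_nz(2)[of n] by (simp add: fl_closed)
    also have "\<dots> = (q - s*z)*(1 - q*z)*prod4 a b c d z / ((1 - s*z^2)^2*(1 - s*q*z^2))"
      unfolding z by (simp add: algebra_simps power2_eq_square power3_eq_cube)
    finally show ?thesis .
  qed
  ultimately show ?thesis
    unfolding zq
    using diagonal_identity[OF s_def y_nz(1-3)[of "Suc n"]] by (simp add: dn_uv en_uv z_def)
qed

lemma e_plus_ac_d_row_0: "en 0 + a*c * dn 0 = a + c"
proof -
  have y0: "q * y 0 = 1" using pow_y(4)[of 0] by simp
  have nz: "1 - s * (y 0)^2 \<noteq> 0" "1 - s \<noteq> 0"
    using y_nz(1)[of 0] s_nz[of 0] by auto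
  have s1: "s*q^2*(y 0)^2 = s" using y0 by algebra
  have "y 0 * (1 - q*y 0 - q^2*y 0 + s*q*(y 0)^2) = - (1 - s * (y 0)^2)" using y0 by algebra
  hence u: "diag_u s q (y 0) = - 1 / (1 - s)"
    unfolding diag_u_def s1 using nz by (simp add: divide_simps)
  have "y 0 * (q - s*y 0 - s*q*y 0 + s*q^2*(y 0)^2) = 1 - s * (y 0)^2" using y0 by algebra
  hence v: "diag_v s q (y 0) = 1 / (1 - s)"
    unfolding diag_v_def s1 using nz by simp
  show ?thesis unfolding dn_uv en_uv u v using nz
    by (simp add: divide_simps) (simp add: s_def algebra_simps)
qed

definition "dop = tri_op dn d_sharp (d_flat a b c d q)"
definition "eop = tri_op en (e_sharp a c q) fl"

lemma lin_dop: "lin_op dop" and lin_eop: "lin_op eop"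
  by (simp_all add: dop_def eop_def lin_op_tri)

lemma q_commutation: "dop (eop v) n = q * eop (dop v) n + (1 - q) * v n"
proof (cases n)
  case 0
  have L: "dop (eop v) n = dn 0 * (en 0 * v 0 - a*c * v 1)
      + (en 1 * v 1 - q*(a*c) * v 2 + fl 0 * v 0)"
    by (simp add: 0 dop_def eop_def tri_op_def d_sharp_def e_sharp_def numeral_2_eq_2)
  have R: "eop (dop v) n = en 0 * (dn 0 * v 0 + v 1)
      - a*c * (dn 1 * v 1 + v 2 - b*d * fl 0 * v 0)"
    by (simp add: 0 dop_def eop_def tri_op_def d_sharp_def e_sharp_def d_flat_fl numeral_2_eq_2)
  have e: "en 1 + a*c*q * dn 1 = q * en 0 + a*c * dn 0"
    using en_Suc[of 0] by simp
  show ?thesis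
    using fl_diag_0 e unfolding L R unfolding 0 s_def by algebra
next
  case (Suc m)
  define Q where "Q = q^m"
  have d: "dn (Suc m) + b*d*(q*Q) * en (Suc m) = q * dn m + b*d*Q * en m"
    using dn_Suc[of m] by (simp add: Q_def)
  have e: "en (Suc (Suc m)) + a*c*(q*(q*Q)) * dn (Suc (Suc m)) = q * en (Suc m) + a*c*(q*Q) * dn (Suc m)"
    using en_Suc[of "Suc m"] by (simp add: Q_def)
  have f: "fl (Suc m) * (1 - s*q^3*Q^2) - fl m * (q - s * Q^2)
     + (1 - q) * (dn (Suc m) * en (Suc m)) = 1 - q"
    using fl_diag_Suc[of m] by (simp add: Q_def)
  define x z where "x = (case m of 0 \<Rightarrow> 0 | Suc j \<Rightarrow> fl j * v j)"
    and "z = (case m of 0 \<Rightarrow> 0 | Suc j \<Rightarrow> d_flat a b c d q j * v j)"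
  have xz: "q * z = - (Q * (b*d)) * x"
    by (simp add: x_def z_def Q_def d_flat_fl split: nat.split)
  have L: "dop (eop v) n = dn (Suc m) * (en (Suc m) * v (Suc m) - q*Q*(a*c) * v (Suc (Suc m)) + fl m * v m)
      + (en (Suc (Suc m)) * v (Suc (Suc m)) - q*(q*Q)*(a*c) * v (Suc (Suc (Suc m))) + fl (Suc m) * v (Suc m))
      - (Q * (b*d)) * fl m * (en m * v m - Q*(a*c) * v (Suc m) + x)"
    by (simp add: Suc dop_def eop_def tri_op_def d_sharp_def e_sharp_def d_flat_fl x_def Q_def)
  have R: "eop (dop v) n = en (Suc m) * (dn (Suc m) * v (Suc m) + v (Suc (Suc m)) - (Q*(b*d)) * fl m * v m)
      - q*Q*(a*c) * (dn (Suc (Suc m)) * v (Suc (Suc m)) + v (Suc (Suc (Suc m))) - (q*Q*(b*d)) * fl (Suc m) * v (Suc m))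
      + fl m * (dn m * v m + v (Suc m) + z)"
    by (simp add: Suc dop_def eop_def tri_op_def d_sharp_def e_sharp_def d_flat_fl z_def Q_def)
  have "dop (eop v) n - q * eop (dop v) n - (1 - q) * v n =
      v (Suc m) * (fl (Suc m) * (1 - s*q^3*Q^2) - fl m * (q - s * Q^2)
        + (1 - q) * (dn (Suc m) * en (Suc m)) - (1 - q))
    + v (Suc (Suc m)) * (en (Suc (Suc m)) + a*c*(q*(q*Q)) * dn (Suc (Suc m)) - (q * en (Suc m) + a*c*(q*Q) * dn (Suc m)))
    + fl m * v m * (dn (Suc m) + b*d*(q*Q) * en (Suc m) - (q * dn m + b*d*Q * en m))
    - fl m * (q * z + (Q * (b*d)) * x)"
    unfolding L R unfolding Suc s_def by algebra
  also have "\<dots> = 0" unfolding d e f xz by simp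
  finally show ?thesis by (simp add: algebra_simps)
qed

end

definition D_op where
  "D_op a b c d q v = (\<lambda>i. (v i + tri_op (d_nat a b c d q) d_sharp (d_flat a b c d q) v i) / (1 - q))"

definition E_op where
  "E_op a b c d q v = (\<lambda>i. (v i + tri_op (e_nat a b c d q) (e_sharp a c q) (e_flat a b c d q) v i) / (1 - q))"

definition A_op where
  "A_op a b c d q v = (\<lambda>i. D_op a b c d q (E_op a b c d q v) i - E_op a b c d q (D_op a b c d q v) i)"

lemma lin_op3:
  assumes "lin_op f"
  shows "f (\<lambda>i. x * u i + y * v i + z * w i) = (\<lambda>i. x * f u i + y * f v i + z * f w i)"
  using lin_opD[OF assms, of 1 "\<lambda>i. x * u i + y * v i" z w] lin_opD[OF assms, of x u y v] by simp

lemma lin_D_op: "lin_op (D_op a b c d q)"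
  by (simp add: lin_op_def D_op_def lin_opD[OF lin_op_tri] fun_eq_iff add_divide_distrib algebra_simps)

lemma lin_E_op: "lin_op (E_op a b c d q)"
  by (simp add: lin_op_def E_op_def lin_opD[OF lin_op_tri] fun_eq_iff add_divide_distrib algebra_simps)

lemma lin_A_op: "lin_op (A_op a b c d q)"
  by (simp add: lin_op_def A_op_def lin_opD[OF lin_E_op] lin_opD[OF lin_D_op] algebra_simps)

context generic_quintuple
begin

abbreviation "Dop \<equiv> D_op a b c d q"
abbreviation "Eop \<equiv> E_op a b c d q"
abbreviation "Aop \<equiv> A_op a b c d q"

lemma Dop: "Dop v = (\<lambda>i. (1/(1-q)) * v i + (1/(1-q)) * dop v i)"
  by (simp add: D_op_def dop_def dn_def add_divide_distrib)

lemma Eop: "Eop v = (\<lambda>i. (1/(1-q)) * v i + (1/(1-q)) * eop v i)"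
  by (simp add: E_op_def eop_def en_def fl_def add_divide_distrib)

lemma Aop: "Aop v i = (dop (eop v) i - eop (dop v) i) / (1-q)^2"
  unfolding A_op_def Dop Eop lin_opD[OF lin_dop] lin_opD[OF lin_eop]
  by (simp add: add_divide_distrib diff_divide_distrib power2_eq_square)

lemma Aop1: "Aop v = (\<lambda>i. (1/(1-q)) * v i + (- 1/(1-q)) * eop (dop v) i)"
proof
  fix i
  have "dop (eop v) i - eop (dop v) i = (1 - q) * (v i - eop (dop v) i)"
    by (simp add: q_commutation algebra_simps)
  hence "Aop v i = (1 - q) * (v i - eop (dop v) i) / (1-q)^2" by (simp add: Aop)
  thus "Aop v i = (1/(1-q)) * v i + (- 1/(1-q)) * eop (dop v) i"
    using q_neq_1 by (simp add: power2_eq_square diff_divide_distrib)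
qed

lemma Aop2: "(\<lambda>i. q * Aop v i) = (\<lambda>i. (1/(1-q)) * v i + (- 1/(1-q)) * dop (eop v) i)"
  using q_neq_1 unfolding Aop1 q_commutation by (simp add: fun_eq_iff divide_simps) (simp add: algebra_simps)

lemma dop_Aop: "dop (Aop v) = (\<lambda>i. q * Aop (dop v) i)"
  unfolding Aop2 unfolding Aop1 lin_opD[OF lin_dop] ..

lemma Aop_eop: "Aop (eop v) = (\<lambda>i. q * eop (Aop v) i)"
proof -
  have "(\<lambda>i. q * eop (Aop v) i) = eop (\<lambda>i. q * Aop v i)"
    by (simp add: lin_op_scale[OF lin_eop])
  also have "\<dots> = Aop (eop v)"
    unfolding Aop2 unfolding Aop1 lin_opD[OF lin_eop] ..
  finally show ?thesis ..
qed

text \<open>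
  \<open>g\<^sub>0\<close> annihilates \<open>\<langle>W|\<close>, and the scaling with \<open>t\<close> is forced by the exchange rule \<open>A g\<^bsub>t+1\<^esub> = q g\<^sub>t A\<close>.
\<close>

definition g_op :: "nat \<Rightarrow> inf_vec \<Rightarrow> inf_vec" where
  "g_op t v = (\<lambda>i. 1 * eop v i + (a*c*(q^t)^2) * dop v i + (- (a + c) * q^t) * v i)"

lemma lin_g_op: "lin_op (g_op t)"
  by (simp add: lin_op_def g_op_def lin_opD[OF lin_eop] lin_opD[OF lin_dop] fun_eq_iff algebra_simps)

lemma Aop_g_op: "Aop (g_op (Suc t) v) = (\<lambda>i. q * g_op t (Aop v) i)"
  unfolding g_op_def lin_op3[OF lin_A_op] Aop_eop dop_Aop
  by (simp add: fun_eq_iff power2_eq_square algebra_simps)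

lemma Aop_scale: "(1 - q) * ((1 - q) * Aop v i) = dop (eop v) i - eop (dop v) i"
  using q_neq_1 by (simp add: Aop power2_eq_square)

lemma lin_Dop_scale:
  assumes "lin_op f"
  shows "(1 - q) * f (Dop v) i = f v i + f (dop v) i"
  unfolding Dop lin_opD[OF assms] using q_neq_1 by (simp add: distrib_left)

lemma lin_Eop_scale:
  assumes "lin_op f"
  shows "(1 - q) * f (Eop v) i = f v i + f (eop v) i"
  unfolding Eop lin_opD[OF assms] using q_neq_1 by (simp add: distrib_left)

lemma Dop_g_op: "Dop (g_op t v) = (\<lambda>i. g_op t (Dop v) i + (1 - q) * Aop v i)"
proof
  fix i
  have "dop (g_op t v) i = g_op t (dop v) i + (dop (eop v) i - eop (dop v) i)"
    unfolding g_op_def lin_op3[OF lin_dop] by simp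
  hence "(1 - q) * Dop (g_op t v) i = (1 - q) * (g_op t (Dop v) i + (1 - q) * Aop v i)"
    using lin_Dop_scale[OF lin_op_id, of "g_op t v" i]
    unfolding distrib_left lin_Dop_scale[OF lin_g_op] Aop_scale by simp
  thus "Dop (g_op t v) i = g_op t (Dop v) i + (1 - q) * Aop v i"
    using q_neq_1 by simp
qed

lemma Eop_g_op: "Eop (g_op t v) = (\<lambda>i. g_op t (Eop v) i - (1 - q) * (a*c*(q^t)^2) * Aop v i)"
proof
  fix i
  have "eop (g_op t v) i = g_op t (eop v) i - (a*c*(q^t)^2) * (dop (eop v) i - eop (dop v) i)"
    unfolding g_op_def lin_op3[OF lin_eop] by (simp add: right_diff_distrib)
  hence "(1 - q) * Eop (g_op t v) i = (1 - q) * g_op t (Eop v) i - (a*c*(q^t)^2) * ((1 - q) * ((1 - q) * Aop v i))"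
    using lin_Eop_scale[OF lin_op_id, of "g_op t v" i]
    unfolding lin_Eop_scale[OF lin_g_op] Aop_scale by simp
  also have "\<dots> = (1 - q) * (g_op t (Eop v) i - (1 - q) * (a*c*(q^t)^2) * Aop v i)"
    by (simp only: right_diff_distrib mult_ac)
  finally show "Eop (g_op t v) i = g_op t (Eop v) i - (1 - q) * (a*c*(q^t)^2) * Aop v i"
    using q_neq_1 by simp
qed

fun B_op :: "nat \<Rightarrow> inf_vec \<Rightarrow> inf_vec" where
  "B_op 0 v = v"
| "B_op (Suc r) v = B_op r (g_op r v)"

lemma lin_B_op: "lin_op (B_op r)"
proof (induction r)
  case 0
  show ?case using lin_op_id by (simp add: lin_op_def)
next
  case (Suc r)
  show ?case using lin_op_comp[OF Suc lin_g_op[of r]] by (simp add: lin_op_def)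
qed

lemma Dop_B_op:
  "Dop (B_op (Suc r) v) = (\<lambda>i. B_op (Suc r) (Dop v) i + (1 - q^Suc r) * B_op r (Aop v) i)"
proof (induction r arbitrary: v)
  case 0
  show ?case by (simp add: Dop_g_op)
next
  case (Suc r)
  have 1: "Dop (g_op (Suc r) v) = (\<lambda>i. 1 * g_op (Suc r) (Dop v) i + (1 - q) * Aop v i)"
    by (simp add: Dop_g_op)
  have "Dop (B_op (Suc (Suc r)) v) = Dop (B_op (Suc r) (g_op (Suc r) v))" by simp
  also have "\<dots> = (\<lambda>i. B_op (Suc r) (Dop (g_op (Suc r) v)) i + (1 - q^Suc r) * B_op r (Aop (g_op (Suc r) v)) i)"
    by (rule Suc)
  also have "\<dots> = (\<lambda>i. B_op (Suc (Suc r)) (Dop v) i + (1 - q^Suc (Suc r)) * B_op (Suc r) (Aop v) i)"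
    unfolding 1 lin_opD[OF lin_B_op] Aop_g_op lin_op_scale[OF lin_B_op]
    by (simp add: fun_eq_iff algebra_simps)
  finally show ?case .
qed

lemma Eop_B_op:
  "Eop (B_op (Suc r) v) = (\<lambda>i. B_op (Suc r) (Eop v) i - a*c*q^r * (1 - q^Suc r) * B_op r (Aop v) i)"
proof (induction r arbitrary: v)
  case 0
  show ?case by (simp add: Eop_g_op mult_ac)
next
  case (Suc r)
  have 1: "Eop (g_op (Suc r) v) = (\<lambda>i. 1 * g_op (Suc r) (Eop v) i + (- ((1 - q) * (a*c*(q^Suc r)^2))) * Aop v i)"
    by (simp add: Eop_g_op)
  have "Eop (B_op (Suc (Suc r)) v) = Eop (B_op (Suc r) (g_op (Suc r) v))" by simp
  also have "\<dots> = (\<lambda>i. B_op (Suc r) (Eop (g_op (Suc r) v)) i - a*c*q^r * (1 - q^Suc r) * B_op r (Aop (g_op (Suc r) v)) i)"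
    by (rule Suc)
  also have "\<dots> = (\<lambda>i. B_op (Suc (Suc r)) (Eop v) i - a*c*q^Suc r * (1 - q^Suc (Suc r)) * B_op (Suc r) (Aop v) i)"
    unfolding 1 lin_opD[OF lin_B_op] Aop_g_op lin_op_scale[OF lin_B_op]
    by (simp add: fun_eq_iff algebra_simps power2_eq_square)
  finally show ?case .
qed

lemma g_op_0: "g_op 0 v 0 = 0"
proof -
  have "g_op 0 v 0 = (en 0 + a*c * dn 0 - (a + c)) * v 0"
    by (simp add: g_op_def eop_def dop_def tri_op_def e_sharp_def d_sharp_def algebra_simps)
  thus ?thesis by (simp add: e_plus_ac_d_row_0)
qed

lemma B_op_0: "B_op (Suc r) v 0 = 0"
  by (induction r arbitrary: v) (simp_all add: g_op_0)

lemma g_op_degree: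
  assumes "\<And>k. k > m \<Longrightarrow> v k = 0"
  shows "k > Suc m \<Longrightarrow> g_op t v k = 0"
    and "g_op t v (Suc m) = fl m * (1 - s * (q^t)^2 * q^m) * v m"
  using assms
  by (auto simp: g_op_def eop_def dop_def tri_op_def d_flat_fl s_def algebra_simps split: nat.split)

lemma B_op_degree:
  assumes "\<And>k. k > m \<Longrightarrow> v k = 0"
  shows "(\<forall>k > m + r. B_op r v k = 0) \<and>
    B_op r v (m + r) = (\<Prod>j<r. fl (m + j) * (1 - s * (q^(r - Suc j))^2 * q^(m + j))) * v m"
  using assms
proof (induction r arbitrary: v m)
  case 0
  then show ?case by simp
next
  case (Suc r)
  have "\<And>k. k > Suc m \<Longrightarrow> g_op r v k = 0" using g_op_degree(1)[of m v] Suc.prems by blast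
  note IH = Suc.IH[of "Suc m" "g_op r v", OF this]
  have top: "g_op r v (Suc m) = fl m * (1 - s * (q^r)^2 * q^m) * v m"
    using g_op_degree(2)[of m v] Suc.prems by blast
  show ?case
    using IH unfolding prod.lessThan_Suc_shift top
    by (simp add: mult_ac)
qed

end

section \<open>Matrices as operators\<close>

fun letter_op where
  "letter_op a b c d q LD = D_op a b c d q"
| "letter_op a b c d q LE = E_op a b c d q"
| "letter_op a b c d q LA = A_op a b c d q"

definition word_op where
  "word_op a b c d q w v = foldr (letter_op a b c d q) w v"

lemma word_op_simps [simp]:
  "word_op a b c d q [] v = v"
  "word_op a b c d q (x # w) v = letter_op a b c d q x (word_op a b c d q w v)"
  "word_op a b c d q (w @ w') v = word_op a b c d q w (word_op a b c d q w' v)"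
  by (simp_all add: word_op_def)

lemma lin_letter_op: "lin_op (letter_op a b c d q x)"
  by (cases x) (simp_all add: lin_D_op lin_E_op lin_A_op)

lemma lin_word_op: "lin_op (word_op a b c d q w)"
proof (induction w)
  case Nil
  show ?case by (simp add: lin_op_def)
next
  case (Cons x w)
  show ?case using lin_op_comp[OF lin_letter_op[of a b c d q x] Cons] by (simp add: lin_op_def)
qed

lemma tridiag_sum:
  assumes "Suc i \<le> m"
  shows "(\<Sum>k\<le>m. tridiag dg up lo i k * v k) = tri_op dg up lo v i"
proof -
  have "(\<Sum>k\<le>m. tridiag dg up lo i k * v k) =
     (\<Sum>k\<le>m. (if k = i then dg i * v i else 0) + (if k = Suc i then up i * v (Suc i) else 0)
       + (if i = Suc k then lo k * v k else 0))"
    by (intro sum.cong) (auto simp: tridiag_def)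
  also have "\<dots> = dg i * v i + up i * v (Suc i) + (\<Sum>k\<le>m. if i = Suc k then lo k * v k else 0)"
    using assms by (simp add: sum.distrib)
  also have "(\<Sum>k\<le>m. if i = Suc k then lo k * v k else 0) = (case i of 0 \<Rightarrow> 0 | Suc j \<Rightarrow> lo j * v j)"
    using assms by (cases i) simp_all
  finally show ?thesis by (simp add: tri_op_def)
qed

lemma scaled_tridiag_sum:
  assumes "Suc i \<le> m"
  shows "(\<Sum>k\<le>m. mat_scale x (mat_add mat_id (tridiag dg up lo)) i k * v k) = x * (v i + tri_op dg up lo v i)"
proof -
  have "(\<Sum>k\<le>m. mat_scale x (mat_add mat_id (tridiag dg up lo)) i k * v k)
     = (\<Sum>k\<le>m. x * ((if k = i then v i else 0) + tridiag dg up lo i k * v k))"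
    by (intro sum.cong) (auto simp: mat_scale_def mat_add_def mat_id_def algebra_simps)
  also have "\<dots> = x * (v i + tri_op dg up lo v i)"
    using assms by (simp add: sum_distrib_left[symmetric] sum.distrib tridiag_sum)
  finally show ?thesis .
qed

lemma mat_D_sum: "Suc i \<le> m \<Longrightarrow> (\<Sum>k\<le>m. mat_D a b c d q i k * v k) = D_op a b c d q v i"
  by (simp add: mat_D_def scaled_tridiag_sum D_op_def)

lemma mat_E_sum: "Suc i \<le> m \<Longrightarrow> (\<Sum>k\<le>m. mat_E a b c d q i k * v k) = E_op a b c d q v i"
  by (simp add: mat_E_def scaled_tridiag_sum E_op_def)

lemma mat_D_band: "k > Suc i \<Longrightarrow> mat_D a b c d q i k = 0"
  and mat_E_band: "k > Suc i \<Longrightarrow> mat_E a b c d q i k = 0"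
  by (simp_all add: mat_D_def mat_E_def mat_scale_def mat_add_def mat_id_def tridiag_def)

lemma mat_mult_band:
  assumes "\<And>k. k > m \<Longrightarrow> M i k = 0"
  shows "mat_mult M N i j = (\<Sum>k\<le>m. M i k * N k j)"
  unfolding mat_mult_def
  by (rule Sum_any.expand_superset) (use assms not_le in \<open>auto intro!: leI\<close>)

lemma mat_A_band: "k > Suc (Suc i) \<Longrightarrow> mat_A a b c d q i k = 0"
  unfolding mat_A_def mat_diff_def
  by (simp add: mat_mult_band[of "Suc i"] mat_D_band mat_E_band)

lemma mat_A_sum:
  assumes "Suc (Suc i) \<le> m"
  shows "(\<Sum>k\<le>m. mat_A a b c d q i k * v k) = A_op a b c d q v i"
proof -
  let ?D = "mat_D a b c d q" and ?E = "mat_E a b c d q"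
  have *: "(\<Sum>k\<le>m. (\<Sum>l\<le>Suc i. M i l * N l k) * v k) = (\<Sum>l\<le>Suc i. M i l * (\<Sum>k\<le>m. N l k * v k))"
    for M N :: inf_mat
    unfolding sum_distrib_left sum_distrib_right
    by (subst sum.swap) (simp add: mult.assoc)
  have "(\<Sum>k\<le>m. mat_A a b c d q i k * v k) =
     (\<Sum>k\<le>m. (\<Sum>l\<le>Suc i. ?D i l * ?E l k) * v k) - (\<Sum>k\<le>m. (\<Sum>l\<le>Suc i. ?E i l * ?D l k) * v k)"
    unfolding mat_A_def mat_diff_def
    by (simp only: mat_mult_band[of "Suc i"] mat_D_band mat_E_band left_diff_distrib sum_subtractf)
  also have "\<dots> = (\<Sum>l\<le>Suc i. ?D i l * E_op a b c d q v l) - (\<Sum>l\<le>Suc i. ?E i l * D_op a b c d q v l)"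
    unfolding * using assms by (simp add: mat_D_sum mat_E_sum)
  also have "\<dots> = A_op a b c d q v i"
    by (simp only: mat_D_sum mat_E_sum order_refl A_op_def)
  finally show ?thesis .
qed

lemma letter_mat_mult: "mat_mult (letter_mat a b c d q x) M i j = letter_op a b c d q x (\<lambda>k. M k j) i"
proof (cases x)
  case LD
  thus ?thesis by (simp add: mat_mult_band[of "Suc i"] mat_D_band mat_D_sum del: sum.atMost_Suc)
next
  case LE
  thus ?thesis by (simp add: mat_mult_band[of "Suc i"] mat_E_band mat_E_sum del: sum.atMost_Suc)
next
  case LA
  thus ?thesis by (simp add: mat_mult_band[of "Suc (Suc i)"] mat_A_band mat_A_sum del: sum.atMost_Suc)
qed

lemma word_mat_entry: "word_mat a b c d q w i j = word_op a b c d q w (ket_V_at j) i"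
proof (induction w arbitrary: i)
  case Nil
  show ?case by (simp add: word_mat_def mat_id_def ket_V_at_def)
next
  case (Cons x w)
  have "word_mat a b c d q (x # w) = mat_mult (letter_mat a b c d q x) (word_mat a b c d q w)"
    by (simp add: word_mat_def)
  thus ?case by (simp add: letter_mat_mult Cons)
qed

lemma bra_mat_ket_entry: "bra_mat_ket bra_W M (ket_V_at r) = M 0 r"
proof -
  have "Sum_any (\<lambda>j. bra_W i * M i j * ket_V_at r j) = bra_W i * M i r" for i
    by (subst Sum_any.expand_superset[of "{r}"]) (auto simp: ket_V_at_def)
  hence "bra_mat_ket bra_W M (ket_V_at r) = Sum_any (\<lambda>i. bra_W i * M i r)"
    by (simp add: bra_mat_ket_def)
  also have "\<dots> = M 0 r"
    by (subst Sum_any.expand_superset[of "{0}"]) (auto simp: bra_W_def)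
  finally show ?thesis .
qed

lemma ket_V_eq: "ket_V = ket_V_at 0"
  by (simp add: ket_V_def bra_W_def ket_V_at_def)

section \<open>Replacing letters\<close>

lemma replacements_Nil: "replacements r [] = (if r = 0 then {[]} else {})"
  by (auto simp: replacements_def)

lemma changed_snoc:
  assumes "length Z = length X"
  shows "{i. i < length (X @ [x]) \<and> (Z @ [z]) ! i \<noteq> (X @ [x]) ! i} =
    {i. i < length X \<and> Z ! i \<noteq> X ! i} \<union> (if z \<noteq> x then {length X} else {})"
  using assms by (auto simp: nth_append less_Suc_eq)

lemma replacements_snoc_iff:
  assumes "length Z = length X" "x \<noteq> LA"
  shows "Z @ [z] \<in> replacements r (X @ [x]) \<longleftrightarrow>
    z = x \<and> Z \<in> replacements r X \<or> z = LA \<and> (\<exists>r'. r = Suc r' \<and> Z \<in> replacements r' X)"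
proof -
  have all: "(\<forall>i < length (X @ [x]). (Z @ [z]) ! i \<noteq> (X @ [x]) ! i \<longrightarrow> (Z @ [z]) ! i = LA) \<longleftrightarrow>
      (\<forall>i < length X. Z ! i \<noteq> X ! i \<longrightarrow> Z ! i = LA) \<and> (z \<noteq> x \<longrightarrow> z = LA)"
    using assms(1) by (auto simp: nth_append less_Suc_eq)
  have fin: "finite {i. i < length X \<and> Z ! i \<noteq> X ! i}" by simp
  show ?thesis
    unfolding replacements_def mem_Collect_eq all changed_snoc[OF assms(1)]
    using assms fin by auto
qed

lemma replacements_snoc:
  assumes "x \<noteq> LA"
  shows "replacements r (X @ [x]) = (\<lambda>Z. Z @ [x]) ` replacements r X \<union>
    (case r of 0 \<Rightarrow> {} | Suc r' \<Rightarrow> (\<lambda>Z. Z @ [LA]) ` replacements r' X)"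
proof (rule set_eqI)
  fix W
  show "W \<in> replacements r (X @ [x]) \<longleftrightarrow> W \<in> (\<lambda>Z. Z @ [x]) ` replacements r X \<union>
    (case r of 0 \<Rightarrow> {} | Suc r' \<Rightarrow> (\<lambda>Z. Z @ [LA]) ` replacements r' X)"
  proof (cases "length W = Suc (length X)")
    case True
    then obtain Z z where W: "W = Z @ [z]" "length Z = length X"
      by (metis append_butlast_last_id length_0_conv length_append_singleton nat.distinct(1) nat.inject)
    show ?thesis
      using replacements_snoc_iff[OF W(2) assms, of z r] unfolding W(1)
      by (auto split: nat.splits)
  next
    case False
    have len: "\<And>Z r Y. Z \<in> replacements r Y \<Longrightarrow> length Z = length Y" by (simp add: replacements_def)
    show ?thesis using False by (auto dest!: len split: nat.splits)
  qed
qed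

lemma finite_replacements: "finite (replacements r X)"
proof (rule finite_subset)
  show "replacements r X \<subseteq> {Z. set Z \<subseteq> {LD, LE, LA} \<and> length Z = length X}"
    using letter.exhaust by (auto simp: replacements_def)
  show "finite {Z. set Z \<subseteq> {LD, LE, LA} \<and> length Z = length X}"
    by (rule finite_lists_length_eq) simp
qed

definition weight :: "complex \<Rightarrow> complex \<Rightarrow> complex \<Rightarrow> wrd \<Rightarrow> wrd \<Rightarrow> complex" where
  "weight \<alpha> \<gamma> q X Z = q ^ inv_E X Z * \<alpha> ^ card (D_pos X Z) * \<gamma> ^ card (E_pos X Z)"

lemma D_pos_snoc:
  assumes "length Z = length X"
  shows "D_pos (X @ [x]) (Z @ [z]) = D_pos X Z \<union> (if x = LD \<and> z = LA then {length X} else {})"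
  using assms by (auto simp: D_pos_def nth_append less_Suc_eq)

lemma E_pos_snoc:
  assumes "length Z = length X"
  shows "E_pos (X @ [x]) (Z @ [z]) = E_pos X Z \<union> (if x = LE \<and> z = LA then {length X} else {})"
  using assms by (auto simp: E_pos_def nth_append less_Suc_eq)

lemma finite_pos [simp]: "finite (D_pos X Z)" "finite (E_pos X Z)"
  by (simp_all add: D_pos_def E_pos_def)

lemma pos_less: "i \<in> D_pos X Z \<Longrightarrow> i < length X" "i \<in> E_pos X Z \<Longrightarrow> i < length X"
  by (simp_all add: D_pos_def E_pos_def)

lemma card_pos:
  assumes "Z \<in> replacements r X" "set X \<subseteq> {LD, LE}"
  shows "card (D_pos X Z \<union> E_pos X Z) = r"
proof -
  have "X ! i = LD \<or> X ! i = LE" if "i < length X" for i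
    using assms(2) nth_mem[OF that] by auto
  hence "D_pos X Z \<union> E_pos X Z = {i. i < length X \<and> Z ! i \<noteq> X ! i}"
    using assms(1) by (fastforce simp: D_pos_def E_pos_def replacements_def)
  thus ?thesis using assms(1) by (simp add: replacements_def)
qed

lemma inv_E_snoc:
  assumes "length Z = length X"
  shows "inv_E (X @ [x]) (Z @ [z]) = inv_E X Z + (if x = LE \<and> z = LA then card (D_pos X Z \<union> E_pos X Z) else 0)"
proof -
  let ?P = "D_pos X Z \<union> E_pos X Z" and ?P' = "D_pos (X @ [x]) (Z @ [z]) \<union> E_pos (X @ [x]) (Z @ [z])"
  have P': "?P' \<subseteq> ?P \<union> {length X}" "?P \<subseteq> ?P'"
    unfolding D_pos_snoc[OF assms] E_pos_snoc[OF assms] by auto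
  have old: "{i \<in> ?P'. i < j} = {i \<in> ?P. i < j}" if "j \<le> length X" for j
    using that P' by auto
  have new: "{i \<in> ?P. i < length X} = ?P" using pos_less by blast
  define f where "f = (\<lambda>j. card {i \<in> ?P'. i < j})"
  have sf: "sum f (E_pos X Z) = inv_E X Z"
    unfolding inv_E_def f_def by (intro sum.cong refl arg_cong[of _ _ card] old) (simp add: pos_less less_imp_le)
  have fl: "f (length X) = card ?P"
    unfolding f_def old[OF order_refl] new ..
  have nin: "length X \<notin> E_pos X Z" using pos_less by blast
  have "inv_E (X @ [x]) (Z @ [z]) = sum f (E_pos (X @ [x]) (Z @ [z]))"
    by (simp only: inv_E_def f_def)
  also have "\<dots> = inv_E X Z + (if x = LE \<and> z = LA then card ?P else 0)"
    using nin unfolding E_pos_snoc[OF assms] by (simp add: sf fl)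
  finally show ?thesis .
qed

lemma weight_snoc:
  assumes "Z \<in> replacements r X" "set X \<subseteq> {LD, LE}"
  shows "x \<noteq> LA \<Longrightarrow> weight \<alpha> \<gamma> q (X @ [x]) (Z @ [x]) = weight \<alpha> \<gamma> q X Z"
    and "weight \<alpha> \<gamma> q (X @ [LD]) (Z @ [LA]) = \<alpha> * weight \<alpha> \<gamma> q X Z"
    and "weight \<alpha> \<gamma> q (X @ [LE]) (Z @ [LA]) = \<gamma> * q^r * weight \<alpha> \<gamma> q X Z"
proof -
  have l: "length Z = length X" using assms(1) by (simp add: replacements_def)
  have n: "length X \<notin> D_pos X Z" "length X \<notin> E_pos X Z" using pos_less by blast+
  show "x \<noteq> LA \<Longrightarrow> weight \<alpha> \<gamma> q (X @ [x]) (Z @ [x]) = weight \<alpha> \<gamma> q X Z"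
    and "weight \<alpha> \<gamma> q (X @ [LD]) (Z @ [LA]) = \<alpha> * weight \<alpha> \<gamma> q X Z"
    and "weight \<alpha> \<gamma> q (X @ [LE]) (Z @ [LA]) = \<gamma> * q^r * weight \<alpha> \<gamma> q X Z"
    using n by (auto simp: weight_def D_pos_snoc[OF l] E_pos_snoc[OF l] inv_E_snoc[OF l] card_pos[OF assms] power_add)
qed

definition replacement_sum where
  "replacement_sum a b c d q r X v = (\<Sum>Z \<in> replacements r X.
     weight (par_alpha a c q) (par_gamma a c q) q X Z * word_op a b c d q Z v 0)"

lemma replacement_sum_snoc:
  assumes X: "set X \<subseteq> {LD, LE}" and x: "x = LD \<or> x = LE"
  shows "replacement_sum a b c d q 0 (X @ [x]) v = replacement_sum a b c d q 0 X (letter_op a b c d q x v)"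
    and "replacement_sum a b c d q (Suc r) (X @ [x]) v =
      replacement_sum a b c d q (Suc r) X (letter_op a b c d q x v) +
      (if x = LD then par_alpha a c q else par_gamma a c q * q^r) * replacement_sum a b c d q r X (A_op a b c d q v)"
proof -
  have xA: "x \<noteq> LA" using x by auto
  let ?t = "\<lambda>W. weight (par_alpha a c q) (par_gamma a c q) q (X @ [x]) W * word_op a b c d q W v 0"
  have inj: "inj_on (\<lambda>Z. Z @ [z]) A" for z and A :: "wrd set" by (auto simp: inj_on_def)
  have keep: "sum ?t ((\<lambda>Z. Z @ [x]) ` replacements r X) = replacement_sum a b c d q r X (letter_op a b c d q x v)" for r
    unfolding sum.reindex[OF inj] replacement_sum_def
    by (intro sum.cong) (simp_all add: weight_snoc(1)[OF _ X xA])
  have repl: "sum ?t ((\<lambda>Z. Z @ [LA]) ` replacements r X) =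
      (if x = LD then par_alpha a c q else par_gamma a c q * q^r) * replacement_sum a b c d q r X (A_op a b c d q v)"
    unfolding sum.reindex[OF inj] replacement_sum_def sum_distrib_left
    by (intro sum.cong) (use x in \<open>auto simp: weight_snoc(2,3)[OF _ X]\<close>)
  show "replacement_sum a b c d q 0 (X @ [x]) v = replacement_sum a b c d q 0 X (letter_op a b c d q x v)"
    using keep[of 0] by (simp add: replacement_sum_def[of _ _ _ _ _ _ "X @ [x]"] replacements_snoc[OF xA])
  have disj: "(\<lambda>Z. Z @ [x]) ` replacements (Suc r) X \<inter> (\<lambda>Z. Z @ [LA]) ` replacements r X = {}"
    using xA by auto
  show "replacement_sum a b c d q (Suc r) (X @ [x]) v =
      replacement_sum a b c d q (Suc r) X (letter_op a b c d q x v) +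
      (if x = LD then par_alpha a c q else par_gamma a c q * q^r) * replacement_sum a b c d q r X (A_op a b c d q v)"
    unfolding replacement_sum_def[of _ _ _ _ _ _ "X @ [x]"] replacements_snoc[OF xA] nat.case
    by (subst sum.union_disjoint) (simp_all only: finite_imageI finite_replacements disj keep repl)
qed

lemma replacements_too_short: "length X < r \<Longrightarrow> replacements r X = {}"
proof (rule ccontr)
  assume "length X < r" "replacements r X \<noteq> {}"
  then obtain Z where "card {i. i < length X \<and> Z ! i \<noteq> X ! i} = r"
    by (auto simp: replacements_def)
  moreover have "card {i. i < length X \<and> Z ! i \<noteq> X ! i} \<le> card {..<length X}"
    by (intro card_mono) auto
  ultimately show False using \<open>length X < r\<close> by simp
qed

lemma replacement_sum_too_short: "length X < r \<Longrightarrow> replacement_sum a b c d q r X v = 0"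
  by (simp add: replacement_sum_def replacements_too_short)

lemma replacement_sum_Nil: "replacement_sum a b c d q r [] v = (if r = 0 then v 0 else 0)"
  by (simp add: replacement_sum_def replacements_Nil weight_def inv_E_def D_pos_def E_pos_def)

lemma replicate_snoc: "replicate (Suc n) x = replicate n x @ [x]"
  by (simp add: replicate_append_same)

lemma replacement_sum_D_power:
  "replacement_sum a b c d q r (replicate r LD) v = par_alpha a c q ^ r * word_op a b c d q (replicate r LA) v 0"
proof (induction r arbitrary: v)
  case 0
  show ?case by (simp add: replacement_sum_Nil)
next
  case (Suc r)
  have "set (replicate r LD) \<subseteq> {LD, LE}" by auto
  from replacement_sum_snoc(2)[OF this, of LD] show ?case
    unfolding replicate_snoc by (simp add: replacement_sum_too_short Suc)
qed

lemma D_power_lowest: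
  assumes "\<And>j. j < k \<Longrightarrow> u j = 0"
  shows "word_op a b c d q (replicate k LD) u 0 = (1/(1-q))^k * u k"
  using assms
proof (induction k arbitrary: u)
  case 0
  show ?case by simp
next
  case (Suc k)
  have "D_op a b c d q u j = 0" if "j < k" for j
    using that Suc.prems by (simp add: D_op_def tri_op_def split: nat.split)
  moreover have "D_op a b c d q u k = u (Suc k) / (1 - q)"
    using Suc.prems by (simp add: D_op_def tri_op_def d_sharp_def split: nat.split)
  ultimately show ?case
    unfolding replicate_snoc by (simp add: Suc.IH)
qed

text \<open>\<open>e\<^sup>\<flat>\<^sub>j\<close> without its factor \<open>1 - q\<^bsup>j+1\<^esup>\<close>, so that it does not vanish at roots of unity.\<close>

definition hfac where
  "hfac a b c d q j = (1 - q powi (int j - 1) * (a*b*c*d)) * prod4 a b c d (q^j)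
    / ((1 - q powi (2 * int j - 1) * (a*b*c*d)) * (1 - q ^ (2*j) * (a*b*c*d))^2 * (1 - q ^ (2*j + 1) * (a*b*c*d)))"

definition A_moment where
  "A_moment a b c d q r = (1/(1-q))^r *
     (\<Prod>j<r. hfac a b c d q j * (1 - a*b*c*d * (q^(r - Suc j))^2 * q^j))"

context generic_quintuple
begin

definition cfac where
  "cfac r = (\<Prod>i<r. (1 - q^Suc i) * ((1 + a*c + a + c) / (1 - q)))"

lemma par_cfac:
  "par_alpha a c q * cfac (Suc r) = (1 - q^Suc r) * cfac r"
  "par_gamma a c q * cfac (Suc r) = - (a*c) * (1 - q^Suc r) * cfac r"
proof -
  define k where "k = (1 + a*c + a + c) / (1 - q)"
  have 1: "par_alpha a c q * k = 1"
    using q_neq_1 denom_nonzero by (simp add: par_alpha_def k_def)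
  have 2: "par_gamma a c q = - (a*c) * par_alpha a c q"
    by (simp add: par_alpha_def par_gamma_def minus_divide_left algebra_simps)
  have 3: "cfac (Suc r) = cfac r * (1 - q^Suc r) * k"
    by (simp add: cfac_def k_def mult_ac)
  have "par_alpha a c q * cfac (Suc r) = (par_alpha a c q * k) * ((1 - q^Suc r) * cfac r)"
    unfolding 3 by (simp only: mult_ac)
  thus 4: "par_alpha a c q * cfac (Suc r) = (1 - q^Suc r) * cfac r"
    unfolding 1 by simp
  show "par_gamma a c q * cfac (Suc r) = - (a*c) * (1 - q^Suc r) * cfac r"
    unfolding 2 mult.assoc 4 ..
qed

lemma alpha_cfac: "par_alpha a c q ^ r * cfac r = (\<Prod>i<r. 1 - q^Suc i)"
proof (induction r)
  case 0
  show ?case by (simp add: cfac_def)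
next
  case (Suc r)
  have "par_alpha a c q ^ Suc r * cfac (Suc r) = par_alpha a c q ^ r * (par_alpha a c q * cfac (Suc r))"
    by (simp add: mult_ac)
  also have "\<dots> = (1 - q^Suc r) * (par_alpha a c q ^ r * cfac r)"
    unfolding par_cfac by (simp only: mult_ac)
  finally show ?case unfolding Suc by (simp add: mult_ac)
qed

text \<open>
  Both sides obey the same recursion when a letter is appended to \<open>X\<close>: on the left the new letter is
  kept or becomes \<open>A\<close>, on the right it is commuted past \<open>B\<^sub>r\<close>.
\<close>

lemma cfac_replacement_sum:
  assumes "set X \<subseteq> {LD, LE}"
  shows "cfac r * replacement_sum a b c d q r X v = word_op a b c d q X (B_op r v) 0"
  using assms
proof (induction X arbitrary: r v rule: rev_induct)
  case Nil
  show ?case by (cases r) (simp_all add: replacement_sum_Nil cfac_def B_op_0 del: B_op.simps(2))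
next
  case (snoc x X)
  have X: "set X \<subseteq> {LD, LE}" and x: "x = LD \<or> x = LE" using snoc.prems by auto
  note IH = snoc.IH[OF X]
  note F = replacement_sum_snoc[OF X x]
  show ?case
  proof (cases r)
    case 0
    thus ?thesis using IH[of 0] by (simp add: F cfac_def)
  next
    case (Suc r')
    define k where "k = (if x = LD then par_alpha a c q else par_gamma a c q * q^r')"
    define l where "l = (if x = LD then 1 - q^Suc r' else - (a*c*q^r' * (1 - q^Suc r')))"
    have kl: "cfac r * k = l * cfac r'"
      using par_cfac[of r'] x unfolding k_def l_def Suc by (auto simp: mult_ac)
    have comm: "letter_op a b c d q x (B_op r v) = (\<lambda>i. 1 * B_op r (letter_op a b c d q x v) i + l * B_op r' (Aop v) i)"
      using x unfolding Suc l_def by (auto simp: Dop_B_op Eop_B_op simp del: B_op.simps(2))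
    have "cfac r * replacement_sum a b c d q r (X @ [x]) v =
        cfac r * replacement_sum a b c d q r X (letter_op a b c d q x v)
        + (cfac r * k) * replacement_sum a b c d q r' X (Aop v)"
      unfolding Suc F(2) k_def by (simp only: distrib_left mult.assoc)
    also have "\<dots> = word_op a b c d q X (B_op r (letter_op a b c d q x v)) 0
        + l * word_op a b c d q X (B_op r' (Aop v)) 0"
      unfolding kl mult.assoc IH ..
    also have "\<dots> = word_op a b c d q X (letter_op a b c d q x (B_op r v)) 0"
      unfolding comm lin_opD[OF lin_word_op] by simp
    finally show ?thesis by simp
  qed
qed

definition lead where "lead r = (\<Prod>j<r. fl j * (1 - s * (q^(r - Suc j))^2 * q^j))"

lemma B_op_ket: "B_op r (ket_V_at 0) = (\<lambda>i. lead r * ket_V_at r i)"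
proof
  fix i
  have deg: "(\<forall>k > r. B_op r (ket_V_at 0) k = 0) \<and> B_op r (ket_V_at 0) r = lead r"
    using B_op_degree[of 0 "ket_V_at 0" r] by (simp add: ket_V_at_def lead_def)
  have low: "B_op r (ket_V_at 0) k = 0" if "k < r" for k
    using that
  proof (induction k rule: less_induct)
    case (less k)
    have "set (replicate k LD) \<subseteq> {LD, LE}" by auto
    from cfac_replacement_sum[OF this, of r "ket_V_at 0"]
    have "word_op a b c d q (replicate k LD) (B_op r (ket_V_at 0)) 0 = 0"
      using less.prems by (simp add: replacement_sum_too_short)
    moreover have "word_op a b c d q (replicate k LD) (B_op r (ket_V_at 0)) 0
        = (1/(1-q))^k * B_op r (ket_V_at 0) k"
      by (rule D_power_lowest) (use less in auto)
    ultimately show ?case using q_neq_1 by simp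
  qed
  show "B_op r (ket_V_at 0) i = lead r * ket_V_at r i"
    using deg low[of i] by (cases i r rule: linorder_cases) (auto simp: ket_V_at_def)
qed

lemma cfac_replacement_sum_ket:
  assumes "set X \<subseteq> {LD, LE}"
  shows "cfac r * replacement_sum a b c d q r X (ket_V_at 0) = lead r * word_op a b c d q X (ket_V_at r) 0"
  using cfac_replacement_sum[OF assms, of r "ket_V_at 0"]
  unfolding B_op_ket lin_op_scale[OF lin_word_op] .

lemma fl_hfac: "fl j = (1 - q^Suc j) * hfac a b c d q j"
proof -
  have "q^Suc j = q^2 * y j" using pow_y(5)[of j] by simp
  thus ?thesis unfolding fl_closed hfac_def pow_y[of j] s_def by (simp add: mult_ac)
qed

lemma lead_A_moment: "lead r * (1/(1-q))^r = (\<Prod>i<r. 1 - q^Suc i) * A_moment a b c d q r"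
  unfolding lead_def A_moment_def fl_hfac s_def
  by (simp add: prod.distrib mult_ac)

lemma nonroot_identities:
  assumes root: "\<And>n. q^Suc n \<noteq> 1" and X: "set X \<subseteq> {LD, LE}"
  shows "word_op a b c d q (replicate r LA) (ket_V_at 0) 0 = A_moment a b c d q r"
    and "replacement_sum a b c d q r X (ket_V_at 0) =
      rho_tilde a c q r * A_moment a b c d q r * word_op a b c d q X (ket_V_at r) 0"
proof -
  define f where "f = (\<Prod>i<r. 1 - q^Suc i)"
  have f: "f \<noteq> 0" using root unfolding f_def by (simp del: power_Suc)
  have "cfac r = f * ((1 + a*c + a + c) / (1 - q))^r"
    unfolding cfac_def f_def prod.distrib by simp
  hence cf: "cfac r \<noteq> 0" using f q_neq_1 denom_nonzero by simp
  have D: "set (replicate r LD) \<subseteq> {LD, LE}" by auto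
  have "cfac r * (par_alpha a c q ^ r * word_op a b c d q (replicate r LA) (ket_V_at 0) 0)
      = lead r * (1/(1-q))^r"
    using cfac_replacement_sum_ket[OF D, of r] D_power_lowest[of r "ket_V_at r"]
    by (simp add: replacement_sum_D_power ket_V_at_def)
  hence "f * word_op a b c d q (replicate r LA) (ket_V_at 0) 0 = f * A_moment a b c d q r"
    unfolding lead_A_moment f_def alpha_cfac[symmetric] by (simp only: mult_ac)
  thus "word_op a b c d q (replicate r LA) (ket_V_at 0) 0 = A_moment a b c d q r"
    using f by simp
  have "lead r = (1-q)^r * (lead r * (1/(1-q))^r)"
    using q_neq_1 by (simp add: power_one_over)
  also have "\<dots> = cfac r * (rho_tilde a c q r * A_moment a b c d q r)"
    unfolding lead_A_moment alpha_cfac[symmetric] rho_tilde_def by (simp only: mult_ac)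
  finally have "cfac r * replacement_sum a b c d q r X (ket_V_at 0) =
      cfac r * (rho_tilde a c q r * A_moment a b c d q r * word_op a b c d q X (ket_V_at r) 0)"
    unfolding cfac_replacement_sum_ket[OF X] by (simp only: mult.assoc)
  thus "replacement_sum a b c d q r X (ket_V_at 0) =
      rho_tilde a c q r * A_moment a b c d q r * word_op a b c d q X (ket_V_at r) 0"
    using cf by simp
qed

lemma A_moment_nz: "A_moment a b c d q r \<noteq> 0"
proof -
  have 1: "1 - q^n * x \<noteq> 0" if "x \<in> {a*b, a*d, b*c, c*d}" for n x
    using gen that unfolding generic_params_def by blast
  have 2: "1 - q powi k * (a*b*c*d) \<noteq> 0" if "k \<ge> -2" for k
    using gen that unfolding generic_params_def by blast
  have 3: "1 - q^k * (a*b*c*d) \<noteq> 0" for k using 2[of "int k"] by simp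
  have "hfac a b c d q j \<noteq> 0" for j
    using 1[of _ j] 2[of "int j - 1"] 2[of "2 * int j - 1"] 3[of "2*j"] 3[of "2*j+1"]
    unfolding hfac_def prod4_def by simp
  moreover have "1 - a*b*c*d * (q^k)^2 * q^j \<noteq> 0" for j k
    using 3[of "k*2 + j"] by (simp add: power_add power_mult mult_ac)
  ultimately show ?thesis using q_neq_1 by (simp add: A_moment_def)
qed

end

section \<open>Roots of unity\<close>

text \<open>
  Genericity allows \<open>q\<close> to be a root of unity, where the product of the \<open>1 - q\<^sup>i\<close> in \<open>cfac\<close> may
  vanish and cannot be cancelled. All other generic \<open>q\<close> accumulate there, as only countably many \<open>q\<close> are excluded.
\<close>

lemma generic_params_near:
  assumes "generic_params a b c d q0" "e > 0"
  shows "\<exists>q \<in> ball q0 e. generic_params a b c d q \<and> (\<forall>n. q^Suc n \<noteq> 1)"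
proof -
  let ?s = "a*b*c*d" and ?S = "{a*b, a*c, a*d, b*c, b*d, c*d}"
  define bad where "bad = insert 0 (insert 1 (insert ?s {q. q^2 = ?s}))
    \<union> (\<Union>n. {q. q^Suc n = 1}) \<union> (\<Union>n. {q. q^Suc n = 1 / ?s}) \<union> (\<Union>x\<in>?S. \<Union>n. {q. q^Suc n = 1 / x})"
  have roots: "countable {q :: complex. q^Suc n = x}" for n x
    by (intro countable_finite finite_nth_roots) simp
  have sq: "countable {q :: complex. q^2 = x}" for x
    by (intro countable_finite finite_nth_roots) simp
  have "countable (\<Union>n. {q :: complex. q^Suc n = x})" for x
    by (rule countable_UN[OF _ roots]) simp
  hence cb: "countable bad"
    unfolding bad_def by (simp add: sq del: power_Suc)
  have "\<not> ball q0 e \<subseteq> bad"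
    using uncountable_ball[OF assms(2), of q0] cb countable_subset by blast
  then obtain q where q: "q \<in> ball q0 e" "q \<notin> bad" by blast
  have pow: "1 - q^n * x \<noteq> 0" if "1 - q0^n * x \<noteq> 0" "\<And>m. q^Suc m \<noteq> 1 / x" for n x
  proof (cases n)
    case 0
    thus ?thesis using that by simp
  next
    case (Suc m)
    show ?thesis
    proof
      assume "1 - q^n * x = 0"
      hence "x \<noteq> 0" "q^Suc m * x = 1" unfolding Suc by auto
      thus False using that(2)[of m] by (simp add: eq_divide_eq del: power_Suc)
    qed
  qed
  have g0: "1 + a*c + a + c \<noteq> 0" "\<And>k::int. k \<ge> -2 \<Longrightarrow> 1 - q0 powi k * ?s \<noteq> 0"
     "\<And>n x. x \<in> ?S \<Longrightarrow> 1 - q0^n * x \<noteq> 0"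
    using assms(1) unfolding generic_params_def by blast+
  have nz: "q \<noteq> 0" "q \<noteq> 1" and root: "q^Suc n \<noteq> 1" for n using q(2) by (auto simp: bad_def)
  have "1 - q powi k * ?s \<noteq> 0" if k: "k \<ge> -2" for k :: int
  proof -
    consider "k \<ge> 0" | "k = -1" | "k = -2"
      using k by linarith
    thus ?thesis
    proof cases
      case 1
      then obtain n where n: "k = int n" using zero_le_imp_eq_int by blast
      have "q^Suc m \<noteq> 1 / ?s" for m using q(2) by (auto simp: bad_def)
      thus ?thesis using pow[of n ?s] g0(2)[of "int n"] by (simp add: n)
    next
      case 2
      have "q \<noteq> ?s" using q(2) by (auto simp: bad_def)
      thus ?thesis using nz by (simp add: 2 field_simps)
    next
      case 3
      have "q^2 \<noteq> ?s" using q(2) by (auto simp: bad_def)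
      thus ?thesis using nz by (simp add: 3 power_int_minus field_simps)
    qed
  qed
  moreover have "1 - q^n * x \<noteq> 0" if "x \<in> ?S" for n x
  proof (rule pow)
    show "1 - q0^n * x \<noteq> 0" using g0(3) that by blast
    show "q^Suc m \<noteq> 1 / x" for m using q(2) that unfolding bad_def by blast
  qed
  ultimately have "generic_params a b c d q"
    using nz g0(1) unfolding generic_params_def by blast
  thus ?thesis using q(1) root by blast
qed

lemma identity_by_continuity:
  fixes f g :: "complex \<Rightarrow> complex"
  assumes "generic_params a b c d q0" "isCont f q0" "isCont g q0"
    and eq: "\<And>q. generic_params a b c d q \<Longrightarrow> (\<And>n. q^Suc n \<noteq> 1) \<Longrightarrow> f q = g q"
  shows "f q0 = g q0"
proof (rule ccontr)
  assume "f q0 \<noteq> g q0"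
  moreover have "((\<lambda>q. f q - g q) \<longlongrightarrow> f q0 - g q0) (nhds q0)"
    using assms(2,3) unfolding continuous_at isCont_def tendsto_at_iff_tendsto_nhds
    by (intro tendsto_diff) simp_all
  ultimately have "eventually (\<lambda>q. f q - g q \<noteq> 0) (nhds q0)"
    by (intro tendsto_imp_eventually_ne) auto
  then obtain e where "e > 0" "\<And>q. dist q q0 < e \<Longrightarrow> f q - g q \<noteq> 0"
    unfolding eventually_nhds_metric by blast
  moreover obtain q where "dist q q0 < e" and q: "generic_params a b c d q" "\<And>n. q^Suc n \<noteq> 1"
    using generic_params_near[OF assms(1) \<open>e > 0\<close>] by (metis dist_commute mem_ball)
  ultimately have "f q - g q \<noteq> 0" by blast
  thus False using eq[OF q] by simp
qed

lemma isCont_tri_op: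
  assumes "\<And>i. isCont (\<lambda>q. dg q i) q0" "\<And>i. isCont (\<lambda>q. up q i) q0" "\<And>i. isCont (\<lambda>q. lo q i) q0"
    and "\<And>i. isCont (\<lambda>q. v q i) q0"
  shows "isCont (\<lambda>q. tri_op (dg q) (up q) (lo q) (v q) i) q0"
  unfolding tri_op_def using assms by (cases i) (auto intro!: continuous_intros)

context generic_quintuple
begin

lemma isCont_entries:
  "isCont (\<lambda>q. d_nat a b c d q i) q" "isCont (\<lambda>q. e_nat a b c d q i) q"
  "isCont (\<lambda>q. d_flat a b c d q i) q" "isCont (\<lambda>q. e_flat a b c d q i) q"
  "isCont (\<lambda>q. e_sharp a c q i) q" "isCont (\<lambda>q. hfac a b c d q i) q"
proof -
  have 1: "1 - q powi k * (a*b*c*d) \<noteq> 0" if "k \<ge> -2" for k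
    using gen that unfolding generic_params_def by blast
  have 2: "1 - q^k * (a*b*c*d) \<noteq> 0" for k using 1[of "int k"] by simp
  have 3: "1 - q^n * (a*c) \<noteq> 0" "1 - q^n * (b*d) \<noteq> 0" for n
    using gen unfolding generic_params_def by blast+
  note nz = 1[of "2 * int i - 2"] 1[of "2 * int i - 1"] 2[of "2*i"] 2[of "2*i+1"] 3[of i] q_nonzero
  show "isCont (\<lambda>q. d_nat a b c d q i) q" "isCont (\<lambda>q. e_nat a b c d q i) q"
    unfolding d_nat_def e_nat_def by (intro continuous_intros; use nz in simp)+
  have cA: "isCont (\<lambda>q. calA a b c d q i) q"
    unfolding calA_def by (intro continuous_intros; use nz in simp)
  show "isCont (\<lambda>q. d_flat a b c d q i) q" "isCont (\<lambda>q. e_flat a b c d q i) q"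
    unfolding d_flat_def e_flat_def by (intro continuous_intros cA; use nz in simp)+
  show "isCont (\<lambda>q. e_sharp a c q i) q"
    unfolding e_sharp_def by (intro continuous_intros)
  show "isCont (\<lambda>q. hfac a b c d q i) q"
    unfolding hfac_def prod4_def by (intro continuous_intros; use nz in simp)
qed

lemma isCont_letter_op:
  assumes v: "\<And>i. isCont (\<lambda>q. v q i) q"
  shows "isCont (\<lambda>q. letter_op a b c d q x (v q) i) q"
proof -
  have D: "isCont (\<lambda>q. D_op a b c d q (u q) i) q" if "\<And>i. isCont (\<lambda>q. u q i) q" for u i
    unfolding D_op_def using q_neq_1
    by (intro continuous_intros isCont_tri_op isCont_entries that) (simp_all add: d_sharp_def)
  have E: "isCont (\<lambda>q. E_op a b c d q (u q) i) q" if "\<And>i. isCont (\<lambda>q. u q i) q" for u i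
    unfolding E_op_def using q_neq_1
    by (intro continuous_intros isCont_tri_op isCont_entries that) simp_all
  show ?thesis
    by (cases x) (auto simp: A_op_def intro!: continuous_intros D E v)
qed

lemma isCont_word_op: "isCont (\<lambda>q. word_op a b c d q w v i) q"
  by (induction w arbitrary: i) (simp_all add: isCont_letter_op)

lemma isCont_A_moment: "isCont (\<lambda>q. A_moment a b c d q r) q"
  unfolding A_moment_def using q_neq_1 by (intro continuous_intros isCont_entries) simp

lemma isCont_par: "isCont (\<lambda>q. par_alpha a c q) q" "isCont (\<lambda>q. par_gamma a c q) q"
  unfolding par_alpha_def par_gamma_def using denom_nonzero by (intro continuous_intros; simp)+

lemma isCont_replacement_sum: "isCont (\<lambda>q. replacement_sum a b c d q r X v) q"
  unfolding replacement_sum_def weight_def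
  by (intro continuous_intros isCont_par isCont_word_op)

lemma A_power_moment: "word_op a b c d q (replicate r LA) (ket_V_at 0) 0 = A_moment a b c d q r"
  by (rule identity_by_continuity[OF gen isCont_word_op isCont_A_moment])
    (rule generic_quintuple.nonroot_identities(1)[of _ _ _ _ _ "[]"], simp_all add: generic_quintuple_def)

lemma replacement_sum_eq:
  assumes "set X \<subseteq> {LD, LE}"
  shows "replacement_sum a b c d q r X (ket_V_at 0) =
      rho_tilde a c q r * A_moment a b c d q r * word_op a b c d q X (ket_V_at r) 0"
proof (rule identity_by_continuity[OF gen isCont_replacement_sum])
  show "isCont (\<lambda>q. rho_tilde a c q r * A_moment a b c d q r * word_op a b c d q X (ket_V_at r) 0) q"
    unfolding rho_tilde_def by (intro continuous_intros isCont_par isCont_A_moment isCont_word_op)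
qed (rule generic_quintuple.nonroot_identities(2), simp_all add: generic_quintuple_def assms)

end

theorem theorem6p2:
  fixes a b c d q :: complex and N r :: nat and X :: wrd
  assumes "generic_params a b c d q"
    and "length X = N" and "set X \<subseteq> {LD, LE}"
  shows "bra_mat_ket bra_W (word_mat a b c d q X) (ket_V_at r) * rho_tilde a c q r =
    (\<Sum>Z \<in> replacements r X.
       q ^ inv_E X Z * par_alpha a c q ^ card (D_pos X Z) * par_gamma a c q ^ card (E_pos X Z) *
       (bra_mat_ket bra_W (word_mat a b c d q Z) ket_V /
        bra_mat_ket bra_W (word_mat a b c d q (replicate r LA)) ket_V))"
proof -
  interpret generic_quintuple a b c d q by unfold_locales (rule assms(1))
  let ?m = "A_moment a b c d q r"
  have "(\<Sum>Z \<in> replacements r X.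
       q ^ inv_E X Z * par_alpha a c q ^ card (D_pos X Z) * par_gamma a c q ^ card (E_pos X Z) *
       (bra_mat_ket bra_W (word_mat a b c d q Z) ket_V /
        bra_mat_ket bra_W (word_mat a b c d q (replicate r LA)) ket_V))
     = replacement_sum a b c d q r X (ket_V_at 0) / ?m"
    unfolding ket_V_eq bra_mat_ket_entry word_mat_entry A_power_moment replacement_sum_def weight_def
      sum_divide_distrib by simp
  also have "\<dots> = word_op a b c d q X (ket_V_at r) 0 * rho_tilde a c q r"
    unfolding replacement_sum_eq[OF assms(3)] using A_moment_nz[of r] by simp
  finally show ?thesis unfolding bra_mat_ket_entry word_mat_entry ..
qed

end
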